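(* Consider the mixed-traffic system defined in the context, in which the tail CAV uses the nominal controller $u_T=k_{T,\mathrm n}(x)$ and the range policy $V_T$ given there. Let $\tau_T>0$, $h_T(x)=s_T-\tau_Tv_T$ and $\mathcal C_T=\{x\in\mathbb{R}^n:h_T(x)\ge0\}$. Suppose that $v_d,v_H,v_i,v_T\in[0,v_{\max}]$ ($i=1,\dots,N$) and $s_T\in[s_{\mathrm{st}},s_{\mathrm{go}}]$, and that the controller parameters satisfy $\kappa\le1/\tau_T$ and $$\alpha_T\ge\Big(|1-\tau_T\beta_{T,N}|+\tau_T\sum_{i\in\mathcal N_T}|\beta_{T,i}|+\tau_T|\beta_{T,H}|\Big)\frac{v_{\max}}{s_{\mathrm{st}}}.$$ Then the system is safe with respect to $\mathcal C_T$; that is, along any solution for which $v_d(t),v_H(t),v_i(t),v_T(t)\in[0,v_{\max}]$ ($i=1,\dots,N$) and $s_T(t)\in[s_{\mathrm{st}},s_{\mathrm{go}}]$ hold for all $t\ge0$, $x(0)\in\mathcal C_T$ implies $x(t)\in\mathcal C_T$ for all $t\ge0$.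
   Context: A platoon consists of a head CAV (H), $N$ human-driven vehicles HV-$1,\dots,$HV-$N$, and a tail CAV (T), behind a leading vehicle with speed $v_d(t)$ (external disturbance). State: $x=[s_H,v_H,s_1,v_1,\dots,s_N,v_N,s_T,v_T]^\top\in\mathbb{R}^n$, $n=2N+4$ (gaps $s$ and speeds $v$). With $v_0:=v_H$ the dynamics are $$\dot s_H=v_d-v_H,\quad\dot v_H=u_H,\qquad\dot s_i=v_{i-1}-v_i,\quad\dot v_i=F_i(s_i,v_i,v_{i-1}-v_i)+d_i\ (i=1,\dots,N),$$ $$\dot s_T=v_N-v_T,\quad\dot v_T=u_T,$$ where $F_i:\mathbb{R}^3\to\mathbb{R}$ are general car-following acceleration functions, $d_i(t)\in\mathbb{R}$ are unmodeled HV dynamics, and $u_H,u_T\in\mathbb{R}$ are the accelerations commanded to the CAVs. The nominal tail controller is $$k_{T,\mathrm n}(x)=\alpha_T(V_T(s_T)-v_T)+\beta_{T,N}(W(v_N)-v_T)+\sum_{i\in\mathcal N_T}\beta_{T,i}(W(v_i)-v_T)+\beta_{T,H}(W(v_H)-v_T),$$ with real gains $\alpha_T,\beta_{T,N},\beta_{T,i},\beta_{T,H}$, index set $\mathcal N_T\subseteq\{1,\dots,N-1\}$, and $W(v)=\min\{v,v_{\max}\}$. The range policy is $V_T(s)=0$ for $s\le s_{\mathrm{st}}$, $\kappa(s-s_{\mathrm{st}})$ for $s_{\mathrm{st}}<s<s_{\mathrm{go}}$, and $v_{\max}$ for $s\ge s_{\mathrm{go}}$, where $v_{\max}>0$, $0<s_{\mathrm{st}}<s_{\mathrm{go}}$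 and $\kappa=v_{\max}/(s_{\mathrm{go}}-s_{\mathrm{st}})$. "Safe with respect to $\mathcal C$" means that $\mathcal C$ is forward invariant: $x(0)\in\mathcal C$ implies $x(t)\in\mathcal C$ for all $t\ge0$. *)

theory Defs
  imports Complex_Main "HOL-Library.FuncSet"
begin

text \<open>
  A state is the vector \<open>[s_H, v_H, s_1, v_1, ..., s_N, v_N, s_T, v_T]\<close> in \<open>R^n\<close>, \<open>n = 2 N + 4\<close>,
  with coordinates numbered from 0. Vehicle 0 is the head CAV, vehicles \<open>1, ..., N\<close> are the
  human-driven ones and vehicle \<open>N + 1\<close> is the tail CAV, so that in particular \<open>v_0 = v_H\<close>.
\<close>

type_synonym state = "nat \<Rightarrow> real"

definition state_space :: "nat \<Rightarrow> state set" where
  "state_space N = {..<2 * N + 4} \<rightarrow>\<^sub>E UNIV"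

definition gap :: "nat \<Rightarrow> state \<Rightarrow> real" where
  "gap i x = x (2 * i)"

definition speed :: "nat \<Rightarrow> state \<Rightarrow> real" where
  "speed i x = x (2 * i + 1)"

abbreviation s_H :: "state \<Rightarrow> real" where "s_H \<equiv> gap 0"
abbreviation v_H :: "state \<Rightarrow> real" where "v_H \<equiv> speed 0"
abbreviation s_T :: "nat \<Rightarrow> state \<Rightarrow> real" where "s_T N \<equiv> gap (N + 1)"
abbreviation v_T :: "nat \<Rightarrow> state \<Rightarrow> real" where "v_T N \<equiv> speed (N + 1)"

text \<open>
  Classical solutions on \<open>[0, \<infinity>)\<close> (one-sided derivative at 0) of the mixed-traffic system whose
  tail CAV applies the state feedback \<open>k_T\<close>. The signals \<open>v_d\<close>, \<open>u_H\<close> and \<open>d i\<close> are arbitrary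
  functions of time; a feedback law of the head CAV is covered by taking for \<open>u_H\<close> its value
  along the solution.
\<close>

definition platoon_solution ::
  "nat \<Rightarrow> (nat \<Rightarrow> real \<Rightarrow> real \<Rightarrow> real \<Rightarrow> real) \<Rightarrow> (nat \<Rightarrow> real \<Rightarrow> real) \<Rightarrow>
   (real \<Rightarrow> real) \<Rightarrow> (real \<Rightarrow> real) \<Rightarrow> (state \<Rightarrow> real) \<Rightarrow> (real \<Rightarrow> state) \<Rightarrow> bool" where
  "platoon_solution N F d v_d u_H k_T x \<longleftrightarrow>
     (\<forall>t\<ge>0. x t \<in> state_space N \<and>
       ((\<lambda>r. s_H (x r)) has_real_derivative v_d t - v_H (x t)) (at t within {0..}) \<and>
       ((\<lambda>r. v_H (x r)) has_real_derivative u_H t) (at t within {0..}) \<and>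
       (\<forall>i\<in>{1..N}.
         ((\<lambda>r. gap i (x r)) has_real_derivative
            speed (i - 1) (x t) - speed i (x t)) (at t within {0..}) \<and>
         ((\<lambda>r. speed i (x r)) has_real_derivative
            F i (gap i (x t)) (speed i (x t)) (speed (i - 1) (x t) - speed i (x t)) + d i t)
            (at t within {0..})) \<and>
       ((\<lambda>r. s_T N (x r)) has_real_derivative speed N (x t) - v_T N (x t)) (at t within {0..}) \<and>
       ((\<lambda>r. v_T N (x r)) has_real_derivative k_T (x t)) (at t within {0..}))"

definition policy_slope :: "real \<Rightarrow> real \<Rightarrow> real \<Rightarrow> real" where
  "policy_slope v_max s_st s_go = v_max / (s_go - s_st)"

definition range_policy :: "real \<Rightarrow> real \<Rightarrow> real \<Rightarrow> real \<Rightarrow> real" where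
  "range_policy v_max s_st s_go s =
     (if s \<le> s_st then 0
      else if s < s_go then policy_slope v_max s_st s_go * (s - s_st)
      else v_max)"

definition speed_policy :: "real \<Rightarrow> real \<Rightarrow> real" where
  "speed_policy v_max v = min v v_max"

definition nominal_tail_controller ::
  "nat \<Rightarrow> real \<Rightarrow> real \<Rightarrow> real \<Rightarrow> real \<Rightarrow> real \<Rightarrow> nat set \<Rightarrow> (nat \<Rightarrow> real) \<Rightarrow> real \<Rightarrow> state \<Rightarrow> real" where
  "nominal_tail_controller N v_max s_st s_go \<alpha>_T \<beta>_TN N_T \<beta>_T \<beta>_TH x =
     \<alpha>_T * (range_policy v_max s_st s_go (s_T N x) - v_T N x)
     + \<beta>_TN * (speed_policy v_max (speed N x) - v_T N x)
     + (\<Sum>i\<in>N_T. \<beta>_T i * (speed_policy v_max (speed i x) - v_T N x))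
     + \<beta>_TH * (speed_policy v_max (v_H x) - v_T N x)"

definition h_T :: "nat \<Rightarrow> real \<Rightarrow> state \<Rightarrow> real" where
  "h_T N \<tau>_T x = s_T N x - \<tau>_T * v_T N x"

definition safe_set_T :: "nat \<Rightarrow> real \<Rightarrow> state set" where
  "safe_set_T N \<tau>_T = {x \<in> state_space N. h_T N \<tau>_T x \<ge> 0}"

text \<open>Forward invariance of \<open>C\<close> along all trajectories in \<open>X\<close>.\<close>

definition safe_wrt :: "(real \<Rightarrow> state) set \<Rightarrow> state set \<Rightarrow> bool" where
  "safe_wrt X C \<longleftrightarrow> (\<forall>x\<in>X. x 0 \<in> C \<longrightarrow> (\<forall>t\<ge>0. x t \<in> C))"

end

theory Submission
  imports Defs
begin

text \<open>
  For \<open>s\<close> in \<open>[s_st, s_go]\<close> the bound on the slope gives \<open>\<tau> V(s) \<le> s - s_st\<close>, that is,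
  \<open>- \<tau> (V(s) - v_T) \<ge> s_st - h\<close>. The gap term of the controller therefore contributes at least
  \<open>\<alpha> s_st - \<alpha> h\<close> to \<open>h'\<close>, and by the bound on \<open>\<alpha>\<close> the summand \<open>\<alpha> s_st\<close> absorbs all speed
  differences, each of absolute value at most \<open>v_max\<close>. Hence \<open>h' \<ge> - \<alpha> h\<close>, not only on the boundary
  of the safe set, so \<open>exp (\<alpha> t) h\<close> is nondecreasing.
\<close>

text \<open>The integrating factor \<open>exp (a * t)\<close> turns the inequality into monotonicity
  of the product \<open>g\<close>; since the factor is positive, \<open>g\<close> has the same sign
  as \<open>f\<close>.\<close>

lemma nonneg_of_linear_differential_inequality:
  fixes f f' :: "real \<Rightarrow> real" and a :: real
  assumes deriv: "\<And>t. t \<ge> 0 \<Longrightarrow> (f has_real_derivative f' t) (at t within {0..})"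
    and ineq: "\<And>t. t \<ge> 0 \<Longrightarrow> f' t \<ge> - a * f t"
    and "f 0 \<ge> 0" and "t \<ge> 0"
  shows "f t \<ge> 0"
proof -
  define g where "g = (\<lambda>t. exp (a * t) * f t)"
  have g_deriv: "(g has_real_derivative exp (a * r) * (f' r + a * f r)) (at r within {0..})"
    if "r \<ge> 0" for r
    unfolding g_def using deriv [OF that]
    by (auto intro!: derivative_eq_intros simp: algebra_simps)
  have "g 0 \<le> g t"
  proof (rule DERIV_nonneg_imp_increasing_open [OF \<open>t \<ge> 0\<close>])
    fix r :: real
    assume "0 < r" "r < t"
    \<comment> \<open>The monotonicity rule wants two-sided derivatives at interior points.
      Shrinking \<open>{0..}\<close> to the open set \<open>{0<..}\<close> makes the derivative
      within the set a full one.\<close>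
    then have "(g has_real_derivative exp (a * r) * (f' r + a * f r)) (at r within {0<..})"
      by (intro DERIV_subset [OF g_deriv]) auto
    then have "(g has_real_derivative exp (a * r) * (f' r + a * f r)) (at r)"
      using \<open>0 < r\<close> by (simp add: at_within_open [of r "{0<..}"])
    moreover have "exp (a * r) * (f' r + a * f r) \<ge> 0"
      using ineq [of r] \<open>0 < r\<close> by simp
    ultimately show "\<exists>y. (g has_real_derivative y) (at r) \<and> 0 \<le> y"
      by blast
  next
    \<comment> \<open>At the end point 0 only continuity is required, and the one-sided derivative
      supplies it.\<close>
    have "continuous_on {0..} g"
      using g_deriv by (intro DERIV_continuous_on) auto
    then show "continuous_on {0..t} g"
      by (rule continuous_on_subset) auto
  qed
  with \<open>f 0 \<ge> 0\<close> have "0 \<le> exp (a * t) * f t"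
    by (simp add: g_def)
  then show ?thesis
    by (simp add: zero_le_mult_iff)
qed

lemma range_policy_le:
  assumes "s_st < s_go" and "\<tau> > 0"
    and "policy_slope v_max s_st s_go \<le> 1 / \<tau>"
    and "s \<in> {s_st..s_go}"
  shows "\<tau> * range_policy v_max s_st s_go s \<le> s - s_st"
proof -
  \<comment> \<open>The linear branch extends to both end points: it vanishes at \<open>s_st\<close>
    and equals \<open>v_max\<close> at \<open>s_go\<close>.\<close>
  have "range_policy v_max s_st s_go s = policy_slope v_max s_st s_go * (s - s_st)"
    using assms(1,4) by (auto simp: range_policy_def policy_slope_def)
  also have "\<dots> \<le> 1 / \<tau> * (s - s_st)"
    using assms(3,4) by (intro mult_right_mono) auto
  finally have "\<tau> * range_policy v_max s_st s_go s \<le> \<tau> * (1 / \<tau> * (s - s_st))"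
    using \<open>\<tau> > 0\<close> by (intro mult_left_mono) auto
  with \<open>\<tau> > 0\<close> show ?thesis
    by simp
qed

lemma abs_mult_diff_le:
  fixes c v w m :: real
  assumes "v \<in> {0..m}" and "w \<in> {0..m}"
  shows "\<bar>c * (v - w)\<bar> \<le> \<bar>c\<bar> * m"
  unfolding abs_mult using assms by (intro mult_left_mono) auto

text \<open>The left-hand side is the closed-loop derivative of \<open>h_T\<close>, taken at a fixed
  state \<open>y\<close>, so that only algebra remains.\<close>

lemma tail_barrier_rate_ge:
  assumes "0 < s_st" and "s_st < s_go" and "\<tau> > 0"
    and "policy_slope v_max s_st s_go \<le> 1 / \<tau>"
    and gain: "\<alpha> \<ge> (\<bar>1 - \<tau> * \<beta>_N\<bar> + \<tau> * (\<Sum>i\<in>I. \<bar>\<beta> i\<bar>) + \<tau> * \<bar>\<beta>_H\<bar>) * (v_max / s_st)"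
    and "speed N y \<in> {0..v_max}" and "v_H y \<in> {0..v_max}"
    and speeds: "\<And>i. i \<in> I \<Longrightarrow> speed i y \<in> {0..v_max}"
    and "v_T N y \<in> {0..v_max}" and "s_T N y \<in> {s_st..s_go}"
  shows "speed N y - v_T N y
      - \<tau> * nominal_tail_controller N v_max s_st s_go \<alpha> \<beta>_N I \<beta> \<beta>_H y
    \<ge> - \<alpha> * h_T N \<tau> y"
proof -
  let ?w = "v_T N y" and ?V = "range_policy v_max s_st s_go (s_T N y)"
  let ?S = "\<Sum>i\<in>I. \<beta> i * (speed i y - ?w)"
  define M where "M = \<bar>1 - \<tau> * \<beta>_N\<bar> + \<tau> * (\<Sum>i\<in>I. \<bar>\<beta> i\<bar>) + \<tau> * \<bar>\<beta>_H\<bar>"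
  have "v_max \<ge> 0"
    using assms(9) by simp
  have "M \<ge> 0"
    using \<open>\<tau> > 0\<close> by (simp add: M_def sum_nonneg)
  have "\<alpha> \<ge> M * (v_max / s_st)"
    using gain by (simp add: M_def)
  then have absorb: "\<alpha> * s_st \<ge> M * v_max"
    using \<open>0 < s_st\<close> by (simp add: field_simps)
  \<comment> \<open>The sign allows the policy bound to be multiplied by \<alpha> below.\<close>
  have "\<alpha> \<ge> 0"
    using \<open>\<alpha> \<ge> M * (v_max / s_st)\<close> \<open>M \<ge> 0\<close> \<open>v_max \<ge> 0\<close> \<open>0 < s_st\<close>
    by (meson divide_nonneg_pos mult_nonneg_nonneg order_trans)
  have "s_st - h_T N \<tau> y \<le> \<tau> * (?w - ?V)"
    using range_policy_le [OF assms(2-4,10)] by (simp add: h_T_def algebra_simps)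
  then have policy: "\<alpha> * (s_st - h_T N \<tau> y) \<le> \<alpha> * (\<tau> * (?w - ?V))"
    using \<open>\<alpha> \<ge> 0\<close> by (rule mult_left_mono)
  have "\<bar>?S\<bar> \<le> (\<Sum>i\<in>I. \<bar>\<beta> i\<bar> * v_max)"
    using speeds assms(9) by (intro order_trans [OF sum_abs] sum_mono abs_mult_diff_le) auto
  then have S: "\<tau> * ?S \<le> \<tau> * ((\<Sum>i\<in>I. \<bar>\<beta> i\<bar>) * v_max)"
    using \<open>\<tau> > 0\<close> by (intro mult_left_mono) (auto simp: sum_distrib_right)
  have H: "\<tau> * (\<beta>_H * (v_H y - ?w)) \<le> \<tau> * (\<bar>\<beta>_H\<bar> * v_max)"
    using abs_mult_diff_le [OF assms(7,9), of \<beta>_H] \<open>\<tau> > 0\<close> by (intro mult_left_mono) auto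
  \<comment> \<open>The difference \<open>speed N y - ?w\<close> enters twice, with coefficient 1
    from the gap dynamics and \<open>- \<tau> * \<beta>_N\<close> from the controller. Bounding the
    combined coefficient yields the first term of \<open>M\<close>.\<close>
  have lead: "(1 - \<tau> * \<beta>_N) * (speed N y - ?w) \<ge> - (\<bar>1 - \<tau> * \<beta>_N\<bar> * v_max)"
    using abs_mult_diff_le [OF assms(6,9), of "1 - \<tau> * \<beta>_N"] by linarith
  \<comment> \<open>No speed exceeds \<open>v_max\<close>, so the saturation
    \<open>speed_policy\<close> acts as the identity.\<close>
  have controller: "nominal_tail_controller N v_max s_st s_go \<alpha> \<beta>_N I \<beta> \<beta>_H y
      = \<alpha> * (?V - ?w) + \<beta>_N * (speed N y - ?w) + ?S + \<beta>_H * (v_H y - ?w)"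
    using assms(6,7) speeds
    by (auto simp: nominal_tail_controller_def speed_policy_def min_def intro!: sum.cong)
  have "speed N y - ?w - \<tau> * nominal_tail_controller N v_max s_st s_go \<alpha> \<beta>_N I \<beta> \<beta>_H y
      = (1 - \<tau> * \<beta>_N) * (speed N y - ?w) + \<alpha> * (\<tau> * (?w - ?V))
        - \<tau> * ?S - \<tau> * (\<beta>_H * (v_H y - ?w))"
    unfolding controller by (simp add: algebra_simps)
  also have "\<dots> \<ge> \<alpha> * (s_st - h_T N \<tau> y) - M * v_max"
    using policy S H lead unfolding M_def distrib_right mult.assoc by linarith
  also have "\<alpha> * (s_st - h_T N \<tau> y) - M * v_max = - \<alpha> * h_T N \<tau> y + (\<alpha> * s_st - M * v_max)"
    by (simp add: algebra_simps)
  finally show ?thesis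
    using absorb by linarith
qed

theorem theorem3:
  fixes N :: nat
    and F :: "nat \<Rightarrow> real \<Rightarrow> real \<Rightarrow> real \<Rightarrow> real"
    and d :: "nat \<Rightarrow> real \<Rightarrow> real"
    and v_d u_H :: "real \<Rightarrow> real"
    and v_max s_st s_go \<tau>_T \<alpha>_T \<beta>_TN \<beta>_TH :: real
    and \<beta>_T :: "nat \<Rightarrow> real"
    and N_T :: "nat set"
  assumes "v_max > 0" and "0 < s_st" and "s_st < s_go"
    and "N_T \<subseteq> {1..<N}"
    and "\<tau>_T > 0"
    and "policy_slope v_max s_st s_go \<le> 1 / \<tau>_T"
    and "\<alpha>_T \<ge> (\<bar>1 - \<tau>_T * \<beta>_TN\<bar> + \<tau>_T * (\<Sum>i\<in>N_T. \<bar>\<beta>_T i\<bar>) + \<tau>_T * \<bar>\<beta>_TH\<bar>) * (v_max / s_st)"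
  shows "safe_wrt
    {x. platoon_solution N F d v_d u_H
          (nominal_tail_controller N v_max s_st s_go \<alpha>_T \<beta>_TN N_T \<beta>_T \<beta>_TH) x \<and>
        (\<forall>t\<ge>0. v_d t \<in> {0..v_max} \<and> v_H (x t) \<in> {0..v_max} \<and>
           (\<forall>i\<in>{1..N}. speed i (x t) \<in> {0..v_max}) \<and>
           v_T N (x t) \<in> {0..v_max} \<and> s_T N (x t) \<in> {s_st..s_go})}
    (safe_set_T N \<tau>_T)"
  unfolding safe_wrt_def
proof (intro ballI impI allI)
  let ?k = "nominal_tail_controller N v_max s_st s_go \<alpha>_T \<beta>_TN N_T \<beta>_T \<beta>_TH"
  fix x t
  assume x: "x \<in> {x. platoon_solution N F d v_d u_H ?k x \<and>
        (\<forall>t\<ge>0. v_d t \<in> {0..v_max} \<and> v_H (x t) \<in> {0..v_max} \<and>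
           (\<forall>i\<in>{1..N}. speed i (x t) \<in> {0..v_max}) \<and>
           v_T N (x t) \<in> {0..v_max} \<and> s_T N (x t) \<in> {s_st..s_go})}"
    and init: "x 0 \<in> safe_set_T N \<tau>_T" and "(t::real) \<ge> 0"
  then have sol: "platoon_solution N F d v_d u_H ?k x"
    by blast
  have "h_T N \<tau>_T (x t) \<ge> 0"
  \<comment> \<open>The rate \<open>a\<close> becomes \<open>\<alpha>_T\<close>, and
    \<open>f'\<close> combines the tail gap equation with the tail speed equation.\<close>
  proof (rule nonneg_of_linear_differential_inequality [where f = "\<lambda>r. h_T N \<tau>_T (x r)"])
    fix r :: real
    assume "r \<ge> 0"
    with sol have "((\<lambda>r. s_T N (x r)) has_real_derivative speed N (x r) - v_T N (x r))
        (at r within {0..})"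
      and "((\<lambda>r. v_T N (x r)) has_real_derivative ?k (x r)) (at r within {0..})"
      unfolding platoon_solution_def by blast+
    then show "((\<lambda>r. h_T N \<tau>_T (x r)) has_real_derivative
        speed N (x r) - v_T N (x r) - \<tau>_T * ?k (x r)) (at r within {0..})"
      unfolding h_T_def by (intro DERIV_diff DERIV_cmult)
    have bounds: "v_H (x r) \<in> {0..v_max}" "\<And>i. i \<in> {1..N} \<Longrightarrow> speed i (x r) \<in> {0..v_max}"
      "v_T N (x r) \<in> {0..v_max}" "s_T N (x r) \<in> {s_st..s_go}"
      using x \<open>r \<ge> 0\<close> by blast+
    \<comment> \<open>For \<open>N = 0\<close> the tail CAV follows the head CAV directly.\<close>
    have "speed N (x r) \<in> {0..v_max}"
      using bounds(1) bounds(2) [of N] by (cases "N = 0") auto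
    moreover have "speed i (x r) \<in> {0..v_max}" if "i \<in> N_T" for i
      using that assms(4) by (intro bounds(2)) auto
    ultimately show "speed N (x r) - v_T N (x r) - \<tau>_T * ?k (x r) \<ge> - \<alpha>_T * h_T N \<tau>_T (x r)"
      using assms(2,3,5-7) bounds(1,3,4) by (intro tail_barrier_rate_ge)
  qed (use init \<open>t \<ge> 0\<close> in \<open>auto simp: safe_set_T_def\<close>)
  moreover have "x t \<in> state_space N"
    using sol \<open>t \<ge> 0\<close> by (simp add: platoon_solution_def)
  ultimately show "x t \<in> safe_set_T N \<tau>_T"
    by (simp add: safe_set_T_def)
qed

end
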